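(* Let $(\mathfrak g,B)$ be an odd-quadratic Lie superalgebra, let $D$ and $\bar D$ be two skew-supersymmetric superderivations of $(\mathfrak g,B)$ which are respectively even and odd, and let $x_0\in\mathfrak g_{\bar0}$, $x_1\in\mathfrak g_{\bar1}$ be such that $$\bar D^2=\tfrac12\mathrm{ad}_{\mathfrak g}(x_0),\quad \bar D(x_0)=0,\quad [D,\bar D]=\mathrm{ad}_{\mathfrak g}(x_1),\quad D(x_0)=2\bar D(x_1),\quad B(x_0,x_1)=0.$$ Let $k\in\mathbb K$. Let $\mathfrak t=\mathbb Ke_0^*\oplus\mathbb Ke_1^*\oplus\mathfrak g\oplus\mathbb Ke_0\oplus\mathbb Ke_1$ be the $\mathbb Z_2$-graded vector space in which $e_0,e_0^*$ are even and $e_1,e_1^*$ are odd, endowed with the even skew-supersymmetric bilinear map $[\,,]$ determined, for $X,Y\in\mathfrak g$, by $$[X,Y]=[X,Y]_{\mathfrak g}+B(\bar D(X),Y)e_0^*+B(D(X),Y)e_1^*,\qquad [e_0,X]=D(X)-B(x_1,X)e_0^*,$$ $$[e_1,X]=\bar D(X)+B(x_0,X)e_0^*+B(x_1,X)e_1^*,\qquad [e_0,e_1]=x_1,\qquad [e_1,e_1]=ke_0^*+x_0,$$ all other brackets of basis elements (those involving $e_0^*$ or $e_1^*$, and $[e_0,e_0]$) being zero. Then $\mathfrak t$ is a Lie superalgebra. Moreover, the supersymmetric bilinear form $\gamma$ on $\mathfrak t$ defined by $\gamma|_{\mathfrak g\times\mathfrak g}=B$, $\gamma(e_0^*,e_1)=1=\gamma(e_1^*,e_0)$,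 and $\gamma$ null elsewhere (up to supersymmetry), is an odd-invariant scalar product on $\mathfrak t$.
   Context: All Lie superalgebras are finite dimensional over an algebraically closed field $\mathbb K$ of characteristic zero; $|x|\in\mathbb Z_2$ is the degree of a homogeneous $X$. A bilinear form on $\mathfrak g$ is odd if it vanishes on $\mathfrak g_\alpha\times\mathfrak g_\alpha$ for all $\alpha\in\mathbb Z_2$. An odd-invariant scalar product $B$ is an odd, supersymmetric ($B(X,Y)=(-1)^{|x||y|}B(Y,X)$), invariant ($B([X,Y],Z)=B(X,[Y,Z])$), non-degenerate bilinear form; $(\mathfrak g,B)$ is then called an odd-quadratic Lie superalgebra. A superderivation $\Delta$ of degree $d$ satisfies $\Delta(\mathfrak g_\alpha)\subseteq \mathfrak g_{\alpha+d}$ and $\Delta[X,Y]=[\Delta(X),Y]+(-1)^{d|x|}[X,\Delta(Y)]$; it is skew-supersymmetric for $B$ if $B(\Delta(X),Y)=-(-1)^{d|x|}B(X,\Delta(Y))$. The bracket of two endomorphisms is the supercommutator. The space $\mathbb Ke_0^*\oplus\mathbb Ke_1^*$ is $P((\mathbb Ke_0\oplus\mathbb Ke_1)^* )$, the parity-shifted dual of the two-dimensional abelian Lie superalgebra $\mathbb Ke_0\oplus\mathbb Ke_1$, with the labelling in which $e_0^*$ spans the shifted dual of $\mathbb Ke_1$ and $e_1^*$ spans the shifted dual of $\mathbb Ke_0$. *)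

theory Defs
  imports
    "HOL-Library.Z2"
    "HOL-Library.Product_Plus"
    "HOL-Computational_Algebra.Polynomial"
begin

section \<open>Lie superalgebras\<close>

text \<open>
  Degrees are elements of \<^typ>\<open>bit\<close>, the integers mod 2. A \<open>\<int>\<^sub>2\<close>-graded vector space is a whole
  type \<open>'v\<close> with a scalar multiplication \<open>s\<close> and its family \<open>V\<close> of homogeneous components.
\<close>

definition ksign :: "bit \<Rightarrow> 'k::field"
  where "ksign p = (if p = 0 then 1 else - 1)"  \<comment> \<open>\<open>(-1)\<close> to the power \<open>p\<close>\<close>

locale super_vector_space = vector_space s
  for s :: "'k::{alg_closed_field,field_char_0} \<Rightarrow> 'v::ab_group_add \<Rightarrow> 'v" +
  fixes V :: "bit \<Rightarrow> 'v set"
  assumes finite_dimensional: "\<exists>Bs. finite_dimensional_vector_space s Bs"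
    and subspace_component: "subspace (V \<alpha>)"
    and components_disjoint: "V 0 \<inter> V 1 = {0}"
    and components_span: "\<exists>y\<in>V 0. \<exists>z\<in>V 1. x = y + z"

definition bilinear_map ::
    "('k::field \<Rightarrow> 'v::ab_group_add \<Rightarrow> 'v) \<Rightarrow> ('k \<Rightarrow> 'w::ab_group_add \<Rightarrow> 'w) \<Rightarrow> ('v \<Rightarrow> 'v \<Rightarrow> 'w) \<Rightarrow> bool"
  where "bilinear_map s s' f \<longleftrightarrow>
    (\<forall>x. Vector_Spaces.linear s s' (\<lambda>y. f x y)) \<and>
    (\<forall>y. Vector_Spaces.linear s s' (\<lambda>x. f x y))"

definition even_map :: "(bit \<Rightarrow> 'v set) \<Rightarrow> ('v \<Rightarrow> 'v \<Rightarrow> 'v) \<Rightarrow> bool"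
  where "even_map V f \<longleftrightarrow> (\<forall>\<alpha> \<beta>. \<forall>x\<in>V \<alpha>. \<forall>y\<in>V \<beta>. f x y \<in> V (\<alpha> + \<beta>))"

definition skew_supersymmetric_map ::
    "('k::field \<Rightarrow> 'v::ab_group_add \<Rightarrow> 'v) \<Rightarrow> (bit \<Rightarrow> 'v set) \<Rightarrow> ('v \<Rightarrow> 'v \<Rightarrow> 'v) \<Rightarrow> bool"
  where "skew_supersymmetric_map s V f \<longleftrightarrow>
    (\<forall>\<alpha> \<beta>. \<forall>x\<in>V \<alpha>. \<forall>y\<in>V \<beta>. f x y = - s (ksign (\<alpha> * \<beta>)) (f y x))"

locale lie_superalgebra = super_vector_space s V
  for s :: "'k::{alg_closed_field,field_char_0} \<Rightarrow> 'v::ab_group_add \<Rightarrow> 'v"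
    and V :: "bit \<Rightarrow> 'v set" +
  fixes br :: "'v \<Rightarrow> 'v \<Rightarrow> 'v"
  assumes bracket_bilinear: "bilinear_map s s br"
    and bracket_even: "even_map V br"
    and bracket_skew: "skew_supersymmetric_map s V br"
    and bracket_jacobi: "\<lbrakk>x \<in> V \<alpha>; y \<in> V \<beta>; z \<in> V \<zeta>\<rbrakk> \<Longrightarrow>
      br x (br y z) = br (br x y) z + s (ksign (\<alpha> * \<beta>)) (br y (br x z))"


section \<open>Odd-invariant scalar products\<close>

definition odd_form :: "(bit \<Rightarrow> 'v set) \<Rightarrow> ('v \<Rightarrow> 'v \<Rightarrow> 'k::field) \<Rightarrow> bool"
  where "odd_form V B \<longleftrightarrow> (\<forall>\<alpha>. \<forall>x\<in>V \<alpha>. \<forall>y\<in>V \<alpha>. B x y = 0)"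

definition supersymmetric_form :: "(bit \<Rightarrow> 'v set) \<Rightarrow> ('v \<Rightarrow> 'v \<Rightarrow> 'k::field) \<Rightarrow> bool"
  where "supersymmetric_form V B \<longleftrightarrow>
    (\<forall>\<alpha> \<beta>. \<forall>x\<in>V \<alpha>. \<forall>y\<in>V \<beta>. B x y = ksign (\<alpha> * \<beta>) * B y x)"

definition invariant_form :: "('v \<Rightarrow> 'v \<Rightarrow> 'v) \<Rightarrow> ('v \<Rightarrow> 'v \<Rightarrow> 'k::field) \<Rightarrow> bool"
  where "invariant_form br B \<longleftrightarrow> (\<forall>x y z. B (br x y) z = B x (br y z))"

definition nondegenerate_form :: "('v::zero \<Rightarrow> 'v \<Rightarrow> 'k::field) \<Rightarrow> bool"
  where "nondegenerate_form B \<longleftrightarrow>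
    (\<forall>x. (\<forall>y. B x y = 0) \<longrightarrow> x = 0) \<and> (\<forall>y. (\<forall>x. B x y = 0) \<longrightarrow> y = 0)"

definition odd_invariant_scalar_product ::
    "('k::field \<Rightarrow> 'v::ab_group_add \<Rightarrow> 'v) \<Rightarrow> (bit \<Rightarrow> 'v set) \<Rightarrow> ('v \<Rightarrow> 'v \<Rightarrow> 'v) \<Rightarrow> ('v \<Rightarrow> 'v \<Rightarrow> 'k) \<Rightarrow> bool"
  where "odd_invariant_scalar_product s V br B \<longleftrightarrow>
    bilinear_map s (*) B \<and> odd_form V B \<and> supersymmetric_form V B \<and>
    invariant_form br B \<and> nondegenerate_form B"

locale odd_quadratic_lie_superalgebra = lie_superalgebra s V br
  for s :: "'k::{alg_closed_field,field_char_0} \<Rightarrow> 'v::ab_group_add \<Rightarrow> 'v"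
    and V :: "bit \<Rightarrow> 'v set" and br :: "'v \<Rightarrow> 'v \<Rightarrow> 'v" +
  fixes B :: "'v \<Rightarrow> 'v \<Rightarrow> 'k"
  assumes odd_invariant: "odd_invariant_scalar_product s V br B"


section \<open>Superderivations\<close>

definition superderivation ::
    "('k::field \<Rightarrow> 'v::ab_group_add \<Rightarrow> 'v) \<Rightarrow> (bit \<Rightarrow> 'v set) \<Rightarrow> ('v \<Rightarrow> 'v \<Rightarrow> 'v) \<Rightarrow> bit \<Rightarrow> ('v \<Rightarrow> 'v) \<Rightarrow> bool"
  where "superderivation s V br d \<Delta> \<longleftrightarrow>
    Vector_Spaces.linear s s \<Delta> \<and>
    (\<forall>\<alpha>. \<forall>x\<in>V \<alpha>. \<Delta> x \<in> V (\<alpha> + d)) \<and>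
    (\<forall>\<alpha>. \<forall>x\<in>V \<alpha>. \<forall>y. \<Delta> (br x y) = br (\<Delta> x) y + s (ksign (d * \<alpha>)) (br x (\<Delta> y)))"

definition skew_supersymmetric_for ::
    "(bit \<Rightarrow> 'v set) \<Rightarrow> ('v \<Rightarrow> 'v \<Rightarrow> 'k::field) \<Rightarrow> bit \<Rightarrow> ('v \<Rightarrow> 'v) \<Rightarrow> bool"
  where "skew_supersymmetric_for V B d \<Delta> \<longleftrightarrow>
    (\<forall>\<alpha>. \<forall>x\<in>V \<alpha>. \<forall>y. B (\<Delta> x) y = - (ksign (d * \<alpha>) * B x (\<Delta> y)))"

definition supercommutator ::
    "('k::field \<Rightarrow> 'v::ab_group_add \<Rightarrow> 'v) \<Rightarrow> bit \<Rightarrow> bit \<Rightarrow> ('v \<Rightarrow> 'v) \<Rightarrow> ('v \<Rightarrow> 'v) \<Rightarrow> 'v \<Rightarrow> 'v"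
  \<comment> \<open>of endomorphisms \<open>F\<close>, \<open>G\<close> of degrees \<open>d\<close>, \<open>d'\<close>\<close>
  where "supercommutator s d d' F G = (\<lambda>x. F (G x) - s (ksign (d * d')) (G (F x)))"


section \<open>The extended space\<close>

text \<open>
  The tuple \<open>(a, b, X, c, d)\<close> stands for \<open>a e\<^sub>0\<^sup>* + b e\<^sub>1\<^sup>* + X + c e\<^sub>0 + d e\<^sub>1\<close>. The parity shift of the
  dual is visible in \<open>t_comp\<close> only: \<open>e\<^sub>0\<^sup>*\<close>, which spans the shifted dual of the line of the odd
  vector \<open>e\<^sub>1\<close>, is even, and \<open>e\<^sub>1\<^sup>*\<close>, which spans that of the line of \<open>e\<^sub>0\<close>, is odd.
\<close>

type_synonym ('k, 'v) t = "'k \<times> 'k \<times> 'v \<times> 'k \<times> 'k"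

definition t_scale :: "('k::field \<Rightarrow> 'v::ab_group_add \<Rightarrow> 'v) \<Rightarrow> 'k \<Rightarrow> ('k, 'v) t \<Rightarrow> ('k, 'v) t"
  where "t_scale s r = (\<lambda>(a, b, X, c, d). (r * a, r * b, s r X, r * c, r * d))"

definition t_comp :: "(bit \<Rightarrow> 'v set) \<Rightarrow> bit \<Rightarrow> ('k::field, 'v) t set"
  where "t_comp V \<alpha> =
    (if \<alpha> = 0 then {(a, 0, X, c, 0) | a X c. X \<in> V 0}
     else {(0, b, X, 0, d) | b X d. X \<in> V 1})"

definition e0s :: "('k::field, 'v::ab_group_add) t" where "e0s = (1, 0, 0, 0, 0)"
definition e1s :: "('k::field, 'v::ab_group_add) t" where "e1s = (0, 1, 0, 0, 0)"
definition e0 :: "('k::field, 'v::ab_group_add) t" where "e0 = (0, 0, 0, 1, 0)"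
definition e1 :: "('k::field, 'v::ab_group_add) t" where "e1 = (0, 0, 0, 0, 1)"
definition incl :: "'v::ab_group_add \<Rightarrow> ('k::field, 'v) t" where "incl X = (0, 0, X, 0, 0)"

definition t_bracket ::
    "('k::field \<Rightarrow> 'v::ab_group_add \<Rightarrow> 'v) \<Rightarrow> (bit \<Rightarrow> 'v set) \<Rightarrow> ('v \<Rightarrow> 'v \<Rightarrow> 'v) \<Rightarrow> ('v \<Rightarrow> 'v \<Rightarrow> 'k) \<Rightarrow>
     ('v \<Rightarrow> 'v) \<Rightarrow> ('v \<Rightarrow> 'v) \<Rightarrow> 'v \<Rightarrow> 'v \<Rightarrow> 'k \<Rightarrow>
     (('k, 'v) t \<Rightarrow> ('k, 'v) t \<Rightarrow> ('k, 'v) t) \<Rightarrow> bool"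
  where "t_bracket s V br B D D' x0 x1 k brt \<longleftrightarrow>
    bilinear_map (t_scale s) (t_scale s) brt \<and>
    even_map (t_comp V) brt \<and>
    skew_supersymmetric_map (t_scale s) (t_comp V) brt \<and>
    (\<forall>X Y. brt (incl X) (incl Y) =
       incl (br X Y) + t_scale s (B (D' X) Y) e0s + t_scale s (B (D X) Y) e1s) \<and>
    (\<forall>X. brt e0 (incl X) = incl (D X) - t_scale s (B x1 X) e0s) \<and>
    (\<forall>X. brt e1 (incl X) = incl (D' X) + t_scale s (B x0 X) e0s + t_scale s (B x1 X) e1s) \<and>
    brt e0 e1 = incl x1 \<and>
    brt e1 e1 = t_scale s k e0s + incl x0 \<and>
    brt e0 e0 = 0 \<and>
    (\<forall>T. brt e0s T = 0) \<and> (\<forall>T. brt e1s T = 0)"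

definition t_form ::
    "('k::field \<Rightarrow> 'v::ab_group_add \<Rightarrow> 'v) \<Rightarrow> (bit \<Rightarrow> 'v set) \<Rightarrow> ('v \<Rightarrow> 'v \<Rightarrow> 'k) \<Rightarrow>
     (('k, 'v) t \<Rightarrow> ('k, 'v) t \<Rightarrow> 'k) \<Rightarrow> bool"
  where "t_form s V B \<gamma> \<longleftrightarrow>
    bilinear_map (t_scale s) (*) \<gamma> \<and>
    supersymmetric_form (t_comp V) \<gamma> \<and>
    (\<forall>X Y. \<gamma> (incl X) (incl Y) = B X Y) \<and>
    \<gamma> e0s e1 = 1 \<and> \<gamma> e1s e0 = 1 \<and>
    \<gamma> e0s e0 = 0 \<and> \<gamma> e1s e1 = 0 \<and>
    \<gamma> e0s e0s = 0 \<and> \<gamma> e0s e1s = 0 \<and> \<gamma> e1s e1s = 0 \<and>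
    \<gamma> e0 e0 = 0 \<and> \<gamma> e0 e1 = 0 \<and> \<gamma> e1 e1 = 0 \<and>
    (\<forall>X. \<gamma> e0s (incl X) = 0 \<and> \<gamma> e1s (incl X) = 0 \<and> \<gamma> e0 (incl X) = 0 \<and> \<gamma> e1 (incl X) = 0)"

end

theory Submission
  imports Defs
begin

text \<open>
  On \<open>g\<close> the new generators \<open>e\<^sub>0\<close> and \<open>e\<^sub>1\<close> act as the derivations \<open>D\<close> and \<open>D'\<close>. The invariance of the
  form dictates the coefficients of \<open>e\<^sub>0\<^sup>*\<close> and \<open>e\<^sub>1\<^sup>*\<close> in a bracket, since the form reads them off by
  pairing with \<open>e\<^sub>1\<close> and \<open>e\<^sub>0\<close>: for instance the coefficient of \<open>e\<^sub>0\<^sup>*\<close> in \<open>[X, Y]\<close> has to be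
  \<open>\<gamma>(X, [Y, e\<^sub>1])\<close>, which is \<open>B(D'X, Y)\<close>. Conversely, with these
  coefficients the form is invariant, as \<open>invariant_ext\<close> checks in coordinates.

  The Jacobi identity is the main point. Let \<open>J(x, y, z)\<close> denote the difference of its two sides.
  Modulo the subspace \<open>\<K>e\<^sub>0\<^sup>* + \<K>e\<^sub>1\<^sup>*\<close> the identity for \<open>(X, Y, Z)\<close> is that of \<open>g\<close>, for \<open>(e\<^sub>i, X, Y)\<close>
  it says that \<open>D\<close> and \<open>D'\<close> are derivations, and the other nontrivial cases are hypotheses on \<open>x\<^sub>0\<close>
  and \<open>x\<^sub>1\<close>, up to the order of the arguments:
  \<open>(e\<^sub>1, e\<^sub>1, X)\<close> is \<open>D'\<^sup>2 = 1/2 ad x\<^sub>0\<close>, \<open>(e\<^sub>0, e\<^sub>1, X)\<close> is \<open>[D, D'] = ad x\<^sub>1\<close>, \<open>(e\<^sub>0, e\<^sub>1, e\<^sub>1)\<close> is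
  \<open>D x\<^sub>0 = 2 D' x\<^sub>1\<close> and \<open>(e\<^sub>1, e\<^sub>1, e\<^sub>1)\<close> is \<open>D' x\<^sub>0 = 0\<close>. Hence every \<open>J(x, y, z)\<close> is a combination of \<open>e\<^sub>0\<^sup>*\<close>
  and \<open>e\<^sub>1\<^sup>*\<close> (\<open>jacobiator_central\<close>).

  The two remaining coefficients need no cocycle computation. For any even skew-supersymmetric bracket
  with an invariant form, \<open>\<gamma>(J(x, y, z), w) = - \<gamma>(x, J(y, z, w))\<close> (\<open>jacobiator_shift\<close>). Here
  \<open>J(y, z, w)\<close> is a combination of \<open>e\<^sub>0\<^sup>*\<close> and \<open>e\<^sub>1\<^sup>*\<close>, which are orthogonal to \<open>g\<close>, \<open>e\<^sub>0\<^sup>*\<close> and \<open>e\<^sub>1\<^sup>*\<close>, so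
  \<open>J(x, y, z) = 0\<close> for \<open>x\<close> in the span of these. Shifting again gives the same for the second and the
  third argument. Only triples of multiples of \<open>e\<^sub>0\<close> and \<open>e\<^sub>1\<close> are left, and there the coefficients
  are values of \<open>B\<close> on \<open>x\<^sub>0\<close> and \<open>x\<^sub>1\<close>; they vanish because \<open>B\<close> is odd and \<open>B(x\<^sub>0, x\<^sub>1) = 0\<close>.

  That the stated values determine the bracket and the form follows by expanding both arguments in the
  generators; the values with the generators in the opposite order come from supersymmetry
  or skew-supersymmetry.
\<close>

section \<open>Graded bilinear maps\<close>

lemma all_bit: "(\<forall>\<alpha>::bit. P \<alpha>) \<longleftrightarrow> P 0 \<and> P 1"
  by (metis bit_not_zero_iff)

lemma ksign_simps [simp]: "ksign 0 = 1" "ksign 1 = - 1"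
  by (auto simp: ksign_def)

lemma bilinear_map_iff:
  "bilinear_map s s' f \<longleftrightarrow> vector_space s \<and> vector_space s' \<and>
    (\<forall>x y z. f (x + y) z = f x z + f y z) \<and> (\<forall>x y z. f x (y + z) = f x y + f x z) \<and>
    (\<forall>c x y. f (s c x) y = s' c (f x y)) \<and> (\<forall>c x y. f x (s c y) = s' c (f x y))"
  unfolding bilinear_map_def Vector_Spaces.linear_iff by blast

lemma bilinear_map_simps:
  assumes "bilinear_map s s' f"
  shows "f (x + y) z = f x z + f y z" "f x (y + z) = f x y + f x z"
    "f (s c x) y = s' c (f x y)" "f x (s c y) = s' c (f x y)"
    "f 0 y = 0" "f x 0 = 0" "f (- x) y = - f x y" "f x (- y) = - f x y"
    "f (x - y) z = f x z - f y z" "f x (y - z) = f x y - f x z"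
proof -
  have "Vector_Spaces.linear s s' (\<lambda>x. f x y)" "Vector_Spaces.linear s s' (f x)" for x y
    using assms by (auto simp: bilinear_map_def)
  then have *: "module_hom s s' (\<lambda>x. f x y)" "module_hom s s' (f x)" for x y
    by (auto simp: Vector_Spaces.linear_def)
  show "f (x + y) z = f x z + f y z" "f x (y + z) = f x y + f x z"
    "f (s c x) y = s' c (f x y)" "f x (s c y) = s' c (f x y)"
    "f 0 y = 0" "f x 0 = 0" "f (- x) y = - f x y" "f x (- y) = - f x y"
    "f (x - y) z = f x z - f y z" "f x (y - z) = f x y - f x z"
    using module_hom.add[OF *(1)] module_hom.add[OF *(2)] module_hom.scale[OF *(1)] module_hom.scale[OF *(2)]
      module_hom.zero[OF *(1)] module_hom.zero[OF *(2)] module_hom.neg[OF *(1)] module_hom.neg[OF *(2)]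
      module_hom.diff[OF *(1)] module_hom.diff[OF *(2)] by auto
qed

context super_vector_space
begin

lemma component_closed:
  "0 \<in> V \<alpha>" "x \<in> V \<alpha> \<Longrightarrow> y \<in> V \<alpha> \<Longrightarrow> x + y \<in> V \<alpha>" "x \<in> V \<alpha> \<Longrightarrow> s c x \<in> V \<alpha>"
  "x \<in> V \<alpha> \<Longrightarrow> - x \<in> V \<alpha>" "x \<in> V \<alpha> \<Longrightarrow> y \<in> V \<alpha> \<Longrightarrow> x - y \<in> V \<alpha>"
  using subspace_component[of \<alpha>]
  by (auto intro: subspace_0 subspace_add subspace_scale subspace_neg subspace_diff)

lemma homogeneous_cases:
  obtains y z where "y \<in> V 0" "z \<in> V 1" "x = y + z"
  using components_span by blast

text \<open>
  The automorphism \<open>x \<mapsto> (-1)\<^bsup>|x|\<^esup> x\<close>. It turns the signs attached to homogeneous elements into a linear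
  map, so that identities containing them can be written for arbitrary elements.
\<close>

definition parity_involution :: "'v \<Rightarrow> 'v"
  where "parity_involution x = (THE w. \<exists>y\<in>V 0. \<exists>z\<in>V 1. x = y + z \<and> w = y - z)"

lemma parity_decomposition:
  assumes "y \<in> V 0" "z \<in> V 1"
  shows "parity_involution (y + z) = y - z"
  unfolding parity_involution_def
proof (rule the_equality)
  fix w assume "\<exists>y'\<in>V 0. \<exists>z'\<in>V 1. y + z = y' + z' \<and> w = y' - z'"
  then obtain y' z' where *: "y' \<in> V 0" "z' \<in> V 1" "y + z = y' + z'" "w = y' - z'" by blast
  then have eq: "y - y' = z' - z" by (simp add: algebra_simps)
  moreover have "y - y' \<in> V 0" "z' - z \<in> V 1"
    using assms * by (auto intro: component_closed)
  ultimately have "y - y' = 0"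
    using components_disjoint by (metis IntI singletonD)
  with eq show "w = y - z" using * by simp
qed (use assms in blast)

lemma parity_homogeneous:
  "x \<in> V 0 \<Longrightarrow> parity_involution x = x" "x \<in> V 1 \<Longrightarrow> parity_involution x = - x"
  using parity_decomposition[of x 0] parity_decomposition[of 0 x] component_closed(1) by auto

lemma parity_linear:
  "parity_involution (x + y) = parity_involution x + parity_involution y"
  "parity_involution (s c x) = s c (parity_involution x)"
proof -
  obtain p q p' q' where *: "p \<in> V 0" "q \<in> V 1" "x = p + q" "p' \<in> V 0" "q' \<in> V 1" "y = p' + q'"
    by (metis homogeneous_cases)
  have e: "x + y = (p + p') + (q + q')" using * by (simp add: algebra_simps)
  have "parity_involution (x + y) = (p + p') - (q + q')"
    unfolding e by (rule parity_decomposition) (use * in \<open>auto intro: component_closed\<close>)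
  then show "parity_involution (x + y) = parity_involution x + parity_involution y"
    using * by (simp add: parity_decomposition algebra_simps)
  have "parity_involution (s c p + s c q) = s c p - s c q"
    by (rule parity_decomposition) (use * in \<open>auto intro: component_closed\<close>)
  then show "parity_involution (s c x) = s c (parity_involution x)"
    using * by (simp add: parity_decomposition scale_right_distrib scale_right_diff_distrib)
qed

lemma parity_zero [simp]: "parity_involution 0 = 0"
  by (rule parity_homogeneous(1)) (rule component_closed)

lemma parity_diff: "parity_involution (x - y) = parity_involution x - parity_involution y"
  by (metis parity_linear(1) add_diff_cancel diff_add_cancel)

lemma parity_minus: "parity_involution (- x) = - parity_involution x"
  using parity_diff[of 0 x] by simp

text \<open>
  With a homogeneous second argument the arguments can be exchanged for arbitrary \<open>x\<close>: the sign
  \<open>(-1)\<^bsup>|x||y|\<^esup>\<close> becomes the involution when \<open>y\<close> is odd.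
\<close>

lemma skew_flip:
  assumes "bilinear_map s s f" "skew_supersymmetric_map s V f"
  shows "y \<in> V 0 \<Longrightarrow> f x y = - f y x" "y \<in> V 1 \<Longrightarrow> f x y = - f y (parity_involution x)"
proof -
  obtain p q where *: "p \<in> V 0" "q \<in> V 1" "x = p + q" by (rule homogeneous_cases)
  have sk: "f u y = - s (ksign (\<alpha> * \<beta>)) (f y u)" if "u \<in> V \<alpha>" "y \<in> V \<beta>" for u y \<alpha> \<beta>
    using assms(2) that unfolding skew_supersymmetric_map_def by blast
  show "f x y = - f y x" if "y \<in> V 0"
    using sk[OF *(1) that] sk[OF *(2) that] * by (simp add: bilinear_map_simps[OF assms(1)])
  show "f x y = - f y (parity_involution x)" if "y \<in> V 1"
    using sk[OF *(1) that] sk[OF *(2) that] *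
    by (simp add: bilinear_map_simps[OF assms(1)] parity_decomposition)
qed

lemma supersymmetric_flip:
  assumes "bilinear_map s (*) f" "supersymmetric_form V f"
  shows "y \<in> V 0 \<Longrightarrow> f x y = f y x" "y \<in> V 1 \<Longrightarrow> f x y = f y (parity_involution x)"
proof -
  obtain p q where *: "p \<in> V 0" "q \<in> V 1" "x = p + q" by (rule homogeneous_cases)
  have sk: "f u y = ksign (\<alpha> * \<beta>) * (f y u)" if "u \<in> V \<alpha>" "y \<in> V \<beta>" for u y \<alpha> \<beta>
    using assms(2) that unfolding supersymmetric_form_def by blast
  show "f x y = f y x" if "y \<in> V 0"
    using sk[OF *(1) that] sk[OF *(2) that] * by (simp add: bilinear_map_simps[OF assms(1)])
  show "f x y = f y (parity_involution x)" if "y \<in> V 1"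
    using sk[OF *(1) that] sk[OF *(2) that] *
    by (simp add: bilinear_map_simps[OF assms(1)] parity_decomposition)
qed

text \<open>
  The degrees are arguments, since an element does not determine its degree (zero has both) and the sign
  also has to make sense for elements that are not homogeneous; the expression is then trilinear.
\<close>

definition jacobiator :: "('v \<Rightarrow> 'v \<Rightarrow> 'v) \<Rightarrow> bit \<Rightarrow> bit \<Rightarrow> 'v \<Rightarrow> 'v \<Rightarrow> 'v \<Rightarrow> 'v"
  where "jacobiator f \<alpha> \<beta> x y z = f x (f y z) - f (f x y) z - s (ksign (\<alpha> * \<beta>)) (f y (f x z))"

lemma jacobiator_add:
  assumes "bilinear_map s s f"
  shows "jacobiator f \<alpha> \<beta> (x + x') y z = jacobiator f \<alpha> \<beta> x y z + jacobiator f \<alpha> \<beta> x' y z"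
    "jacobiator f \<alpha> \<beta> x (y + y') z = jacobiator f \<alpha> \<beta> x y z + jacobiator f \<alpha> \<beta> x y' z"
    "jacobiator f \<alpha> \<beta> x y (z + z') = jacobiator f \<alpha> \<beta> x y z + jacobiator f \<alpha> \<beta> x y z'"
  by (simp_all add: jacobiator_def bilinear_map_simps[OF assms] scale_right_distrib)

text \<open>
  Move the brackets of each of the three terms across the form by invariance. Two terms reach
  \<open>\<gamma> x\<close> directly; the third, \<open>[y, [x, z]]\<close>, first has to be turned into \<open>[[x, z], y]\<close>, and the
  resulting sign combines with the one in front of the term to the sign in the jacobiator of \<open>y\<close>, \<open>z\<close>, \<open>w\<close>.
\<close>

lemma jacobiator_shift:
  assumes f: "bilinear_map s s f" "even_map V f" "skew_supersymmetric_map s V f"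
    and \<gamma>: "bilinear_map s (*) \<gamma>" "invariant_form f \<gamma>"
    and x: "x \<in> V \<alpha>" and y: "y \<in> V \<beta>" and z: "z \<in> V \<zeta>"
  shows "\<gamma> (jacobiator f \<alpha> \<beta> x y z) w = - \<gamma> x (jacobiator f \<beta> \<zeta> y z w)"
proof -
  have inv: "\<gamma> (f p q) r = \<gamma> p (f q r)" for p q r
    using \<gamma>(2) by (simp add: invariant_form_def)
  have "f x z \<in> V (\<alpha> + \<zeta>)" using f(2) x z by (auto simp: even_map_def)
  then have flip: "f y (f x z) = - s (ksign (\<beta> * (\<alpha> + \<zeta>))) (f (f x z) y)"
    using f(3) y unfolding skew_supersymmetric_map_def by blast
  have "ksign (\<alpha> * \<beta>) * ksign (\<beta> * (\<alpha> + \<zeta>)) = (ksign (\<beta> * \<zeta>) :: 'k)"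
    by (cases \<alpha>; cases \<beta>; cases \<zeta>) simp_all
  then show ?thesis
    unfolding jacobiator_def flip
    by (simp add: bilinear_map_simps[OF \<gamma>(1)] inv algebra_simps)
qed

end

section \<open>The extended graded vector space\<close>

lemma t_scale_simps [simp]:
  "t_scale s r (a, b, X, c, d) = (r * a, r * b, s r X, r * c, r * d)"
  by (simp add: t_scale_def)

lemma t_comp_iff [simp]:
  "(a, b, X, c, d) \<in> t_comp V 0 \<longleftrightarrow> X \<in> V 0 \<and> b = 0 \<and> d = 0"
  "(a, b, X, c, d) \<in> t_comp V 1 \<longleftrightarrow> X \<in> V 1 \<and> a = 0 \<and> c = 0"
  by (auto simp: t_comp_def)

lemma t_decomposition:
  assumes "vector_space s"
  shows "(a, b, X, c, d) =
    t_scale s a e0s + t_scale s b e1s + incl X + t_scale s c e0 + t_scale s d e1"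
proof -
  interpret vector_space s by fact
  show ?thesis by (simp add: e0s_def e1s_def e0_def e1_def incl_def)
qed

context super_vector_space
begin

lemma vector_space_t: "vector_space (t_scale s)"
  by unfold_locales (auto simp: algebra_simps scale_right_distrib scale_left_distrib)

lemma finite_dimensional_t: "\<exists>Bs. finite_dimensional_vector_space (t_scale s) Bs"
proof -
  interpret T: vector_space "t_scale s" by (rule vector_space_t)
  obtain Bs where "finite_dimensional_vector_space s Bs"
    using finite_dimensional by blast
  then interpret F: finite_dimensional_vector_space s Bs .
  let ?S = "incl ` Bs \<union> {e0s, e1s, e0, e1} :: ('k \<times> 'k \<times> 'v \<times> 'k \<times> 'k) set"
  have lin: "Vector_Spaces.linear s (t_scale s) incl"
    by (auto simp: Vector_Spaces.linear_iff vector_space_t vector_space_axioms incl_def)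
  then interpret L: Vector_Spaces.linear s "t_scale s" incl .
  have "incl X \<in> T.span ?S" for X
  proof -
    have "incl X \<in> incl ` span Bs" using F.span_Basis by simp
    also have "\<dots> = T.span (incl ` Bs)" by (simp add: L.span_image)
    finally show ?thesis using T.span_mono[of "incl ` Bs" ?S] by blast
  qed
  then have "(a, b, X, c, d) \<in> T.span ?S" for a b X c d
    unfolding t_decomposition[OF vector_space_axioms, of a b X c d]
    by (intro T.span_add T.span_scale) (auto intro: T.span_base)
  then have span: "T.span ?S = UNIV" by auto
  obtain Bs' where *: "Bs' \<subseteq> ?S" "T.independent Bs'" "?S \<subseteq> T.span Bs'"
    by (rule T.maximal_independent_subset)
  have "finite Bs'" using *(1) F.finite_Basis by (auto intro: finite_subset)
  moreover have "T.span Bs' = UNIV"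
    using span T.span_mono[OF *(3)] by (simp add: T.span_span top.extremum_unique)
  ultimately have "finite_dimensional_vector_space (t_scale s) Bs'"
    by unfold_locales (use *(2) in auto)
  then show ?thesis by blast
qed

lemma super_vector_space_t: "super_vector_space (t_scale s) (t_comp V)"
proof -
  interpret T: vector_space "t_scale s" by (rule vector_space_t)
  have sub: "T.subspace (t_comp V \<alpha>)" for \<alpha>
    by (cases \<alpha>) (auto simp: T.subspace_def zero_prod_def component_closed)
  have span: "\<exists>y\<in>t_comp V 0. \<exists>z\<in>t_comp V 1. x = y + z" for x :: "'k \<times> 'k \<times> 'v \<times> 'k \<times> 'k"
  proof -
    obtain a b X c d where x: "x = (a, b, X, c, d)" by (cases x) auto
    obtain Y Z where "Y \<in> V 0" "Z \<in> V 1" "X = Y + Z" by (rule homogeneous_cases)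
    then have "(a, 0, Y, c, 0) \<in> t_comp V 0" "(0, b, Z, 0, d) \<in> t_comp V 1"
      "x = (a, 0, Y, c, 0) + (0, b, Z, 0, d)" using x by auto
    then show ?thesis by blast
  qed
  have disj: "t_comp V 0 \<inter> t_comp V 1 = {0 :: 'k \<times> 'k \<times> 'v \<times> 'k \<times> 'k}"
    using components_disjoint component_closed(1)
    by (auto simp: zero_prod_def)
  show ?thesis
    by unfold_locales (auto intro!: finite_dimensional_t sub disj span)
qed

lemma parity_parity: "parity_involution (parity_involution x) = x"
proof -
  obtain p q where *: "p \<in> V 0" "q \<in> V 1" "x = p + q" by (rule homogeneous_cases)
  then show ?thesis
    using parity_decomposition[of p "- q"] by (simp add: parity_decomposition component_closed)
qed

lemma parity_t: "super_vector_space.parity_involution (t_comp V) (a :: 'k, b :: 'k, X, c :: 'k, d :: 'k) =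
  (a, - b, parity_involution X, c, - d)"
proof -
  interpret T: super_vector_space "t_scale s" "t_comp V" by (rule super_vector_space_t)
  obtain Y Z where *: "Y \<in> V 0" "Z \<in> V 1" "X = Y + Z" by (rule homogeneous_cases)
  then show ?thesis
    using T.parity_decomposition[of "(a, 0, Y, c, 0)" "(0, b, Z, 0, d)"]
    by (simp add: parity_decomposition)
qed

end

section \<open>The data of an odd double extension\<close>

locale odd_double_extension = odd_quadratic_lie_superalgebra s V br B
  for s :: "'k::{alg_closed_field,field_char_0} \<Rightarrow> 'v::ab_group_add \<Rightarrow> 'v"
    and V :: "bit \<Rightarrow> 'v set" and br :: "'v \<Rightarrow> 'v \<Rightarrow> 'v" and B :: "'v \<Rightarrow> 'v \<Rightarrow> 'k" +
  fixes D D' :: "'v \<Rightarrow> 'v" and x0 x1 :: 'v and k :: 'k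
  assumes derivation_D: "superderivation s V br 0 D"
    and skew_D: "skew_supersymmetric_for V B 0 D"
    and derivation_D': "superderivation s V br 1 D'"
    and skew_D': "skew_supersymmetric_for V B 1 D'"
    and x0: "x0 \<in> V 0" and x1: "x1 \<in> V 1"
    and D'_squared: "D' \<circ> D' = (\<lambda>X. s (1 / 2) (br x0 X))"
    and D'_x0: "D' x0 = 0"
    and D_D': "supercommutator s 0 1 D D' = br x1"
    and D_x0: "D x0 = s 2 (D' x1)"
    and B_x0_x1: "B x0 x1 = 0"
begin

lemma B_bilinear: "bilinear_map s (*) B" and B_odd: "odd_form V B"
  and B_super: "supersymmetric_form V B" and B_invariant: "invariant_form br B"
  and B_nondegenerate: "nondegenerate_form B"
  using odd_invariant by (auto simp: odd_invariant_scalar_product_def)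

lemmas br_simps = bilinear_map_simps[OF bracket_bilinear]
lemmas B_simps = bilinear_map_simps[OF B_bilinear]

lemma D_linear:
  "D (x + y) = D x + D y" "D (s c x) = s c (D x)" "D 0 = 0" "D (- x) = - D x" "D (x - y) = D x - D y"
  "D' (x + y) = D' x + D' y" "D' (s c x) = s c (D' x)" "D' 0 = 0" "D' (- x) = - D' x"
  "D' (x - y) = D' x - D' y"
proof -
  have "module_hom s s D" "module_hom s s D'"
    using derivation_D derivation_D' by (auto simp: superderivation_def Vector_Spaces.linear_def)
  then show "D (x + y) = D x + D y" "D (s c x) = s c (D x)" "D 0 = 0" "D (- x) = - D x" "D (x - y) = D x - D y"
    "D' (x + y) = D' x + D' y" "D' (s c x) = s c (D' x)" "D' 0 = 0" "D' (- x) = - D' x"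
    "D' (x - y) = D' x - D' y"
    by (auto simp: module_hom.add module_hom.scale module_hom.zero module_hom.neg module_hom.diff)
qed

lemmas parity_simps = parity_linear parity_homogeneous

lemma D_degree: "X \<in> V \<alpha> \<Longrightarrow> D X \<in> V \<alpha>" "X \<in> V 0 \<Longrightarrow> D' X \<in> V 1" "X \<in> V 1 \<Longrightarrow> D' X \<in> V 0"
proof -
  have "D X \<in> V (\<alpha> + 0)" "D' X \<in> V (\<alpha> + 1)" if "X \<in> V \<alpha>" for \<alpha>
    using derivation_D derivation_D' that unfolding superderivation_def by blast+
  from this[of \<alpha>] this[of 0] this[of 1]
  show "X \<in> V \<alpha> \<Longrightarrow> D X \<in> V \<alpha>" "X \<in> V 0 \<Longrightarrow> D' X \<in> V 1" "X \<in> V 1 \<Longrightarrow> D' X \<in> V 0"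
    by (simp_all only: add_0 add_0_right one_add_one bit_2_eq_0)
qed

lemma br_degree:
  "X \<in> V 0 \<Longrightarrow> Y \<in> V \<beta> \<Longrightarrow> br X Y \<in> V \<beta>" "X \<in> V \<beta> \<Longrightarrow> Y \<in> V 0 \<Longrightarrow> br X Y \<in> V \<beta>"
  "X \<in> V 1 \<Longrightarrow> Y \<in> V 1 \<Longrightarrow> br X Y \<in> V 0"
proof -
  have "br X Y \<in> V (\<alpha> + \<beta>)" if "X \<in> V \<alpha>" "Y \<in> V \<beta>" for \<alpha> \<beta>
    using bracket_even that unfolding even_map_def by blast
  from this[of 0 \<beta>] this[of \<beta> 0] this[of 1 1]
  show "X \<in> V 0 \<Longrightarrow> Y \<in> V \<beta> \<Longrightarrow> br X Y \<in> V \<beta>" "X \<in> V \<beta> \<Longrightarrow> Y \<in> V 0 \<Longrightarrow> br X Y \<in> V \<beta>"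
    "X \<in> V 1 \<Longrightarrow> Y \<in> V 1 \<Longrightarrow> br X Y \<in> V 0"
    by (simp_all only: add_0 add_0_right one_add_one bit_2_eq_0)
qed

lemma B_odd_simps:
  "X \<in> V 0 \<Longrightarrow> Y \<in> V 0 \<Longrightarrow> B X Y = 0" "X \<in> V 1 \<Longrightarrow> Y \<in> V 1 \<Longrightarrow> B X Y = 0"
  using B_odd by (auto simp: odd_form_def)

text \<open>
  An odd form pairs only elements of opposite degree, and for these the sign of supersymmetry is \<open>1\<close>.
\<close>

lemma B_commute: "B X Y = B Y X"
proof -
  obtain p q where *: "p \<in> V 0" "q \<in> V 1" "X = p + q" by (rule homogeneous_cases)
  obtain p' q' where q: "p' \<in> V 0" "q' \<in> V 1" "Y = p' + q'" by (rule homogeneous_cases)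
  have "B u v = ksign (\<alpha> * \<beta>) * B v u" if "u \<in> V \<alpha>" "v \<in> V \<beta>" for u v \<alpha> \<beta>
    using B_super that unfolding supersymmetric_form_def by blast
  from this[OF *(1) q(2)] this[OF *(2) q(1)] show ?thesis
    using * q by (simp add: B_simps B_odd_simps)
qed

lemma B_inv: "B (br X Y) Z = B X (br Y Z)"
  using B_invariant by (simp add: invariant_form_def)

lemma B_parity: "B x0 (parity_involution X) = - B x0 X" "B x1 (parity_involution X) = B x1 X"
    "B (parity_involution X) Y = - B X (parity_involution Y)"
proof -
  obtain p q where *: "p \<in> V 0" "q \<in> V 1" "X = p + q" by (rule homogeneous_cases)
  obtain p' q' where q: "p' \<in> V 0" "q' \<in> V 1" "Y = p' + q'" by (rule homogeneous_cases)
  show "B x0 (parity_involution X) = - B x0 X" "B x1 (parity_involution X) = B x1 X"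
    "B (parity_involution X) Y = - B X (parity_involution Y)"
    using * q x0 x1 by (simp_all add: B_simps parity_decomposition B_odd_simps)
qed

lemma B_D: "B (D X) Y = - B X (D Y)"
proof -
  obtain p q where *: "p \<in> V 0" "q \<in> V 1" "X = p + q" by (rule homogeneous_cases)
  have "B (D u) Y = - (ksign (0 * \<alpha>) * B u (D Y))" if "u \<in> V \<alpha>" for u \<alpha>
    using skew_D that unfolding skew_supersymmetric_for_def by blast
  from this[OF *(1)] this[OF *(2)] show ?thesis using * by (simp add: B_simps D_linear)
qed

text \<open>
  Skew-supersymmetry of an odd map carries a sign depending on the degree of \<open>X\<close>, which the involution
  absorbs.
\<close>

lemma B_D': "B (D' X) Y = - B (parity_involution X) (D' Y)"
proof -
  obtain p q where *: "p \<in> V 0" "q \<in> V 1" "X = p + q" by (rule homogeneous_cases)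
  have "B (D' u) Y = - (ksign (1 * \<alpha>) * B u (D' Y))" if "u \<in> V \<alpha>" for u \<alpha>
    using skew_D' that unfolding skew_supersymmetric_for_def by blast
  from this[OF *(1)] this[OF *(2)] show ?thesis
    using * by (simp add: B_simps D_linear parity_decomposition)
qed

lemma parity_D': "parity_involution (D' X) = - D' (parity_involution X)"
proof -
  obtain p q where *: "p \<in> V 0" "q \<in> V 1" "X = p + q" by (rule homogeneous_cases)
  have "parity_involution (D' q + D' p) = D' q - D' p"
    using * by (intro parity_decomposition) (auto intro: D_degree)
  then show ?thesis using * by (simp add: parity_decomposition D_linear add.commute)
qed

lemma D_br: "D (br X Y) = br (D X) Y + br X (D Y)"
proof -
  obtain p q where *: "p \<in> V 0" "q \<in> V 1" "X = p + q" by (rule homogeneous_cases)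
  have "D (br u Y) = br (D u) Y + s (ksign (0 * \<alpha>)) (br u (D Y))" if "u \<in> V \<alpha>" for u \<alpha>
    using derivation_D that unfolding superderivation_def by blast
  from this[OF *(1)] this[OF *(2)] show ?thesis using * by (simp add: br_simps D_linear)
qed

lemma D'_br:
  "X \<in> V 0 \<Longrightarrow> D' (br X Y) = br (D' X) Y + br X (D' Y)"
  "X \<in> V 1 \<Longrightarrow> D' (br X Y) = br (D' X) Y - br X (D' Y)"
proof -
  have *: "D' (br X Y) = br (D' X) Y + s (ksign (1 * \<alpha>)) (br X (D' Y))" if "X \<in> V \<alpha>" for \<alpha>
    using derivation_D' that unfolding superderivation_def by blast
  show "X \<in> V 0 \<Longrightarrow> D' (br X Y) = br (D' X) Y + br X (D' Y)"
    "X \<in> V 1 \<Longrightarrow> D' (br X Y) = br (D' X) Y - br X (D' Y)"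
    using *[of 0] *[of 1] by simp_all
qed

text \<open>
  The square of \<open>D'\<close> is used to eliminate brackets with \<open>x\<^sub>0\<close>, not the other way round, and the factor
  \<open>1/2\<close> becomes a sum: the rewriting in the Jacobi computation then stays free of fractions.
\<close>

lemma br_x0: "br x0 X = D' (D' X) + D' (D' X)"
  using fun_cong[OF D'_squared, of X] by (simp flip: scale_left_distrib)

lemma D_x0_eq: "D x0 = D' x1 + D' x1"
  using D_x0 scale_left_distrib[of 1 1 "D' x1"] by simp

lemma D_D'_swap: "D (D' X) = D' (D X) + br x1 X"
  using fun_cong[OF D_D', of X] by (simp add: supercommutator_def algebra_simps)

lemma br_flip:
  "X \<in> V 0 \<Longrightarrow> Y \<in> V 0 \<Longrightarrow> br Y X = - br X Y"
  "X \<in> V 0 \<Longrightarrow> Y \<in> V 1 \<Longrightarrow> br Y X = - br X Y"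
  "X \<in> V 1 \<Longrightarrow> Y \<in> V 0 \<Longrightarrow> br Y X = - br X Y"
  "X \<in> V 1 \<Longrightarrow> Y \<in> V 1 \<Longrightarrow> br Y X = br X Y"
proof -
  have *: "br Y X = - s (ksign (\<beta> * \<alpha>)) (br X Y)" if "X \<in> V \<alpha>" "Y \<in> V \<beta>" for \<alpha> \<beta>
    using bracket_skew that unfolding skew_supersymmetric_map_def by blast
  show "X \<in> V 0 \<Longrightarrow> Y \<in> V 0 \<Longrightarrow> br Y X = - br X Y" "X \<in> V 0 \<Longrightarrow> Y \<in> V 1 \<Longrightarrow> br Y X = - br X Y"
    "X \<in> V 1 \<Longrightarrow> Y \<in> V 0 \<Longrightarrow> br Y X = - br X Y" "X \<in> V 1 \<Longrightarrow> Y \<in> V 1 \<Longrightarrow> br Y X = br X Y"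
    using *[of 0 0] *[of 1 0] *[of 0 1] *[of 1 1] by simp_all
qed

lemma br_br:
  assumes "X \<in> V \<alpha>" "Y \<in> V \<beta>"
  shows "br (br X Y) Z = br X (br Y Z) - s (ksign (\<alpha> * \<beta>)) (br Y (br X Z))"
proof -
  obtain p q where *: "p \<in> V 0" "q \<in> V 1" "Z = p + q" by (rule homogeneous_cases)
  show ?thesis
    using bracket_jacobi[OF assms *(1)] bracket_jacobi[OF assms *(2)] *
    by (simp add: br_simps scale_right_distrib)
qed

section \<open>The extended bracket and form\<close>

text \<open>
  The bracket \<open>[X, e\<^sub>1]\<close> is \<open>- (-1)\<^bsup>|X|\<^esup> [e\<^sub>1, X]\<close>, whence the involution in the third coordinate. In the
  first two coordinates it has been evaluated: \<open>B x0\<close> is supported on odd and \<open>B x1\<close> on even elements,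
  so that the sign is a constant on each of them.
\<close>

definition bracket_ext :: "('k, 'v) t \<Rightarrow> ('k, 'v) t \<Rightarrow> ('k, 'v) t"
  where "bracket_ext = (\<lambda>(a, b, X, c, d) (a', b', X', c', d').
    (B (D' X) X' - c * B x1 X' + c' * B x1 X + d * B x0 X' + d' * B x0 X + d * d' * k,
     B (D X) X' + d * B x1 X' - d' * B x1 X,
     br X X' + s c (D X') - s c' (D X) + s d (D' X') - s d' (D' (parity_involution X))
       + s (c * d' - d * c') x1 + s (d * d') x0,
     0, 0))"

lemma bracket_ext_simps [simp]: "bracket_ext (a, b, X, c, d) (a', b', X', c', d') =
    (B (D' X) X' - c * B x1 X' + c' * B x1 X + d * B x0 X' + d' * B x0 X + d * d' * k,
     B (D X) X' + d * B x1 X' - d' * B x1 X,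
     br X X' + s c (D X') - s c' (D X) + s d (D' X') - s d' (D' (parity_involution X))
       + s (c * d' - d * c') x1 + s (d * d') x0,
     0, 0)"
  by (simp add: bracket_ext_def)

definition form_ext :: "('k, 'v) t \<Rightarrow> ('k, 'v) t \<Rightarrow> 'k"
  where "form_ext = (\<lambda>(a, b, X, c, d) (a', b', X', c', d'). B X X' + a * d' + d * a' + b * c' + c * b')"

lemma form_ext_simps [simp]:
  "form_ext (a, b, X, c, d) (a', b', X', c', d') = B X X' + a * d' + d * a' + b * c' + c * b'"
  by (simp add: form_ext_def)

lemmas s_simps = scale_right_distrib scale_left_distrib scale_right_diff_distrib scale_left_diff_distrib

lemma bracket_ext_bilinear: "bilinear_map (t_scale s) (t_scale s) bracket_ext"
  unfolding bilinear_map_iff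
  by (auto simp: vector_space_t br_simps B_simps D_linear parity_linear s_simps algebra_simps)

lemma form_ext_bilinear: "bilinear_map (t_scale s) (*) form_ext"
proof -
  have "vector_space ((*) :: 'k \<Rightarrow> 'k \<Rightarrow> 'k)" by unfold_locales (auto simp: algebra_simps)
  then show ?thesis
    unfolding bilinear_map_iff by (auto simp: vector_space_t B_simps algebra_simps)
qed

lemma bracket_ext_even: "even_map (t_comp V) bracket_ext"
  unfolding even_map_def all_bit
  using x0 x1
  by (auto simp: parity_homogeneous D_linear D_degree br_degree B_odd_simps intro!: component_closed)

lemma bracket_ext_skew: "skew_supersymmetric_map (t_scale s) (t_comp V) bracket_ext"
proof -
  have D: "B (D X) Y = - B (D Y) X" and D': "B (D' X) Y = - B (D' Y) (parity_involution X)" for X Y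
    by (metis B_D B_commute) (metis B_D' B_commute)
  have "bracket_ext (a, b, X, c, d) (a', b', X', c', d') =
    - t_scale s (ksign (\<alpha> * \<beta>)) (bracket_ext (a', b', X', c', d') (a, b, X, c, d))"
    if "(a, b, X, c, d) \<in> t_comp V \<alpha>" "(a', b', X', c', d') \<in> t_comp V \<beta>"
    for \<alpha> \<beta> a b X c d a' b' X' c' d'
    using that x0 x1 D[of X X'] D'[of X X']
    by (cases \<alpha>; cases \<beta>)
      (auto simp: parity_homogeneous B_simps D_linear s_simps B_odd_simps D_degree br_flip[where X = X' and Y = X]
        scale_minus_left algebra_simps)
  then show ?thesis unfolding skew_supersymmetric_map_def by (metis prod_cases5)
qed

lemma form_ext_super: "supersymmetric_form (t_comp V) form_ext"
  unfolding supersymmetric_form_def all_bit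
  by (auto simp: B_commute B_odd_simps)

lemma form_ext_odd: "odd_form (t_comp V) form_ext"
  unfolding odd_form_def all_bit
  by (auto simp: B_odd_simps)

lemma form_ext_nondegenerate: "nondegenerate_form form_ext"
proof -
  have sym: "form_ext x y = form_ext y x" for x y
    by (cases x; cases y) (auto simp: B_commute)
  have "x = 0" if *: "\<And>y. form_ext x y = 0" for x
  proof -
    obtain a b X c d where x: "x = (a, b, X, c, d)" by (cases x) auto
    have "B X Y = 0" for Y using *[of "(0, 0, Y, 0, 0)"] x by (simp add: B_simps)
    then have "X = 0" using B_nondegenerate by (auto simp: nondegenerate_form_def)
    then show ?thesis
      using *[of "(1, 0, 0, 0, 0)"] *[of "(0, 1, 0, 0, 0)"] *[of "(0, 0, 0, 1, 0)"] *[of "(0, 0, 0, 0, 1)"] x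
      by (simp add: B_simps zero_prod_def)
  qed
  with sym show ?thesis unfolding nondegenerate_form_def by metis
qed

text \<open>
  The invariance of \<open>B\<close> and the skewness of \<open>D\<close>, \<open>D'\<close> and the involution move these maps to the second
  argument of \<open>B\<close>, where both sides agree term by term.
\<close>

lemma invariant_ext: "invariant_form bracket_ext form_ext"
proof -
  have "form_ext (bracket_ext (a, b, X, c, d) (a', b', X', c', d')) (a'', b'', X'', c'', d'') =
    form_ext (a, b, X, c, d) (bracket_ext (a', b', X', c', d') (a'', b'', X'', c'', d''))"
    for a b X c d a' b' X' c' d' a'' b'' X'' c'' d''
    using B_commute[of X x0] B_commute[of X x1]
    by (simp add: B_simps B_inv B_D B_D' B_parity parity_D' parity_parity D_linear algebra_simps)
  then show ?thesis unfolding invariant_form_def by (metis prod_cases5)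
qed

section \<open>Existence and uniqueness\<close>

lemmas t_unit_simps = e0s_def e1s_def e0_def e1_def incl_def

lemma t_bracket_bracket_ext: "t_bracket s V br B D D' x0 x1 k bracket_ext"
  unfolding t_bracket_def
  by (auto simp: bracket_ext_bilinear bracket_ext_even bracket_ext_skew t_unit_simps br_simps B_simps D_linear zero_prod_def)

lemma t_form_form_ext: "t_form s V B form_ext"
  unfolding t_form_def
  by (auto simp: form_ext_bilinear form_ext_super t_unit_simps B_simps)

lemma t_bracket_unique:
  assumes "t_bracket s V br B D D' x0 x1 k brt"
  shows "brt = bracket_ext"
proof -
  interpret T: super_vector_space "t_scale s" "t_comp V" by (rule super_vector_space_t)
  have bil: "bilinear_map (t_scale s) (t_scale s) brt"
    and skew: "skew_supersymmetric_map (t_scale s) (t_comp V) brt"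
    and gens: "brt (incl X) (incl Y) =
       incl (br X Y) + t_scale s (B (D' X) Y) e0s + t_scale s (B (D X) Y) e1s"
      "brt e0 (incl X) = incl (D X) - t_scale s (B x1 X) e0s"
      "brt e1 (incl X) = incl (D' X) + t_scale s (B x0 X) e0s + t_scale s (B x1 X) e1s"
      "brt e0 e1 = incl x1" "brt e1 e1 = t_scale s k e0s + incl x0" "brt e0 e0 = 0"
      "brt e0s T = 0" "brt e1s T = 0" for X Y T
    using assms unfolding t_bracket_def by blast+
  have comps: "e0s \<in> t_comp V 0" "e1s \<in> t_comp V 1" "e0 \<in> t_comp V 0" "e1 \<in> t_comp V 1"
    by (auto simp: t_unit_simps component_closed)
  note fl = T.skew_flip[OF bil skew]
  have flips: "brt x e0s = 0" "brt x e1s = 0" "brt (incl X) e0 = - brt e0 (incl X)"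
    "brt (incl X) e1 = - brt e1 (incl (parity_involution X))" "brt e1 e0 = - brt e0 e1" for x X
    using fl(1)[OF comps(1), of x] fl(2)[OF comps(2), of x] fl(1)[OF comps(3), of "incl X"]
      fl(2)[OF comps(4), of "incl X"] fl(1)[OF comps(3), of e1]
    by (simp_all add: gens parity_t incl_def)
  have "brt (a, b, X, c, d) (a', b', X', c', d') = bracket_ext (a, b, X, c, d) (a', b', X', c', d')"
    for a b X c d a' b' X' c' d'
    unfolding t_decomposition[OF vector_space_axioms, of a b X c d]
      t_decomposition[OF vector_space_axioms, of a' b' X' c' d']
    unfolding bilinear_map_simps[OF bil] gens flips
    by (simp add: t_unit_simps zero_prod_def B_simps D_linear B_parity s_simps algebra_simps)
  then show ?thesis by (intro ext) (metis prod_cases5)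
qed

lemma t_form_unique:
  assumes "t_form s V B \<gamma>"
  shows "\<gamma> = form_ext"
proof -
  interpret T: super_vector_space "t_scale s" "t_comp V" by (rule super_vector_space_t)
  have bil: "bilinear_map (t_scale s) (*) \<gamma>" and super: "supersymmetric_form (t_comp V) \<gamma>"
    and gens: "\<gamma> (incl X) (incl Y) = B X Y" "\<gamma> e0s e1 = 1" "\<gamma> e1s e0 = 1" "\<gamma> e0s e0 = 0"
      "\<gamma> e1s e1 = 0" "\<gamma> e0s e0s = 0" "\<gamma> e0s e1s = 0" "\<gamma> e1s e1s = 0" "\<gamma> e0 e0 = 0" "\<gamma> e0 e1 = 0"
      "\<gamma> e1 e1 = 0" "\<gamma> e0s (incl X) = 0" "\<gamma> e1s (incl X) = 0" "\<gamma> e0 (incl X) = 0" "\<gamma> e1 (incl X) = 0"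
    for X Y
    using assms by (auto simp: t_form_def)
  have comps: "e0s \<in> t_comp V 0" "e1s \<in> t_comp V 1" "e0 \<in> t_comp V 0" "e1 \<in> t_comp V 1"
    by (auto simp: t_unit_simps component_closed)
  note fl = T.supersymmetric_flip[OF bil super]
  have flips: "\<gamma> (incl X) e0s = 0" "\<gamma> (incl X) e1s = 0" "\<gamma> (incl X) e0 = 0" "\<gamma> (incl X) e1 = 0"
    "\<gamma> e1s e0s = 0" "\<gamma> e0 e0s = 0" "\<gamma> e1 e0s = 1" "\<gamma> e0 e1s = 1" "\<gamma> e1 e1s = 0" "\<gamma> e1 e0 = 0" for X
  proof -
    have par: "T.parity_involution (incl X) = incl (parity_involution X)" "T.parity_involution e0 = e0"
      "T.parity_involution e1 = - e1"
      by (simp_all add: parity_t t_unit_simps parity_homogeneous component_closed)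
    show "\<gamma> (incl X) e0s = 0" "\<gamma> (incl X) e1s = 0" "\<gamma> (incl X) e0 = 0" "\<gamma> (incl X) e1 = 0"
      "\<gamma> e1s e0s = 0" "\<gamma> e0 e0s = 0" "\<gamma> e1 e0s = 1" "\<gamma> e0 e1s = 1" "\<gamma> e1 e1s = 0" "\<gamma> e1 e0 = 0"
      using fl(1)[OF comps(1), of "incl X"] fl(2)[OF comps(2), of "incl X"]
        fl(1)[OF comps(3), of "incl X"] fl(2)[OF comps(4), of "incl X"]
        fl(1)[OF comps(1), of e1s] fl(1)[OF comps(1), of e0] fl(1)[OF comps(1), of e1]
        fl(2)[OF comps(2), of e0] fl(2)[OF comps(2), of e1] fl(1)[OF comps(3), of e1]
      by (simp_all add: par gens bilinear_map_simps[OF bil])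
  qed
  have "\<gamma> (a, b, X, c, d) (a', b', X', c', d') = form_ext (a, b, X, c, d) (a', b', X', c', d')"
    for a b X c d a' b' X' c' d'
    unfolding t_decomposition[OF vector_space_axioms, of a b X c d]
      t_decomposition[OF vector_space_axioms, of a' b' X' c' d']
    unfolding bilinear_map_simps[OF bil] bilinear_map_simps[OF form_ext_bilinear] gens flips
    by (simp add: t_unit_simps B_simps algebra_simps)
  then show ?thesis by (intro ext) (metis prod_cases5)
qed

section \<open>The Jacobi identity\<close>

text \<open>
  The normal form has \<open>D'\<close> to the left of \<open>D\<close>, brackets nested to the right, and no brackets with \<open>x\<^sub>0\<close>: these become
  squares of \<open>D'\<close>. The third argument may be arbitrary: no sign depends on its
  degree, and this is what the shift of the jacobiator asks for.
\<close>

lemma jacobiator_central: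
  assumes "(a, b, X, c, d) \<in> t_comp V \<alpha>" "(a', b', Y, c', d') \<in> t_comp V \<beta>"
  shows "snd (snd (super_vector_space.jacobiator (t_scale s) bracket_ext \<alpha> \<beta>
    (a, b, X, c, d) (a', b', Y, c', d') (a'', b'', Z, c'', d''))) = 0"
proof -
  interpret T: super_vector_space "t_scale s" "t_comp V" by (rule super_vector_space_t)
  \<comment> \<open>Only these instances: an unrestricted exchange rule can rewrite in circles.\<close>
  note flips = br_flip[where X = X and Y = Y]
    br_flip[where X = "D X" and Y = Y] br_flip[where X = "D' X" and Y = Y]
    br_flip[where X = x0 and Y = X] br_flip[where X = x1 and Y = X]
    br_flip[where X = x0 and Y = Y] br_flip[where X = x1 and Y = Y]
  note simps = T.jacobiator_def parity_linear parity_diff parity_homogeneous br_simps D_linear s_simps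
    br_br[of X 0 Y 0 Z] br_br[of X 0 Y 1 Z] br_br[of X 1 Y 0 Z] br_br[of X 1 Y 1 Z]
    D_br D'_br D_D'_swap br_x0 D_degree br_degree D'_x0 D_x0_eq
  show ?thesis
    using assms x0 x1
    by (cases \<alpha>; cases \<beta>) (auto simp: simps flips zero_prod_def algebra_simps)
qed

text \<open>
  Only the dependence on the components along \<open>e\<^sub>0\<close> and \<open>e\<^sub>1\<close> survives: the components in the orthogonal
  complement of \<open>\<K>e\<^sub>0\<^sup>* + \<K>e\<^sub>1\<^sup>*\<close> are removed one argument after the other.
\<close>

lemma jacobi_ext:
  assumes "x \<in> t_comp V \<alpha>" "y \<in> t_comp V \<beta>" "z \<in> t_comp V \<zeta>"
  shows "super_vector_space.jacobiator (t_scale s) bracket_ext \<alpha> \<beta> x y z = 0"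
proof -
  interpret T: super_vector_space "t_scale s" "t_comp V" by (rule super_vector_space_t)
  let ?J = "T.jacobiator bracket_ext"
  let ?g = "\<lambda>(a, b, X, c, d). (a, b, X, 0, 0) :: ('k, 'v) t"
  let ?e = "\<lambda>(a, b, X, c, d). (0, 0, 0, c, d) :: ('k, 'v) t"
  have split: "t = ?g t + ?e t" for t by (cases t) auto
  have homogeneous: "?g t \<in> t_comp V \<alpha> \<and> ?e t \<in> t_comp V \<alpha>" if "t \<in> t_comp V \<alpha>" for t \<alpha>
    using that by (cases \<alpha>; cases t) (auto simp: component_closed)
  note add = T.jacobiator_add[OF bracket_ext_bilinear]
  note shift = T.jacobiator_shift[OF bracket_ext_bilinear bracket_ext_even bracket_ext_skew
      form_ext_bilinear invariant_ext]
  have nondegenerate: "t = 0" if "\<And>w. form_ext t w = 0" for t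
    using form_ext_nondegenerate that unfolding nondegenerate_form_def by blast
  \<comment> \<open>The jacobiator on the right of the shift is central, hence orthogonal to \<open>?g x\<close>.\<close>
  have first: "?J \<alpha> \<beta> (?g x) y z = 0"
    if "x \<in> t_comp V \<alpha>" "y \<in> t_comp V \<beta>" "z \<in> t_comp V \<zeta>" for x y z \<alpha> \<beta> \<zeta>
  proof (rule nondegenerate)
    fix w
    have "snd (snd (?J \<beta> \<zeta> y z w)) = 0"
      using jacobiator_central that by (metis prod_cases5)
    then obtain p q where "?J \<beta> \<zeta> y z w = (p, q, 0, 0, 0)"
      by (cases "?J \<beta> \<zeta> y z w") (auto simp: zero_prod_def)
    then show "form_ext (?J \<alpha> \<beta> (?g x) y z) w = 0"
      using shift[of "?g x" \<alpha> y \<beta> z \<zeta> w] homogeneous[OF that(1)] that by (cases x) (simp add: B_simps)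
  qed
  \<comment> \<open>The shift below produces an arbitrary third argument, so homogeneity is dropped there.\<close>
  have first': "?J \<alpha> \<beta> (?g x) y z = 0"
    if "x \<in> t_comp V \<alpha>" "y \<in> t_comp V \<beta>" for x y z \<alpha> \<beta>
  proof -
    obtain p q where "p \<in> t_comp V 0" "q \<in> t_comp V 1" "z = p + q" by (rule T.homogeneous_cases)
    then show ?thesis using first[OF that] by (simp add: add)
  qed
  have second: "?J \<alpha> \<beta> x (?g y) z = 0"
    if "x \<in> t_comp V \<alpha>" "y \<in> t_comp V \<beta>" "z \<in> t_comp V \<zeta>" for x y z \<alpha> \<beta> \<zeta>
    using shift[of x \<alpha> "?g y" \<beta> z \<zeta>] first'[of y \<beta> z \<zeta>] homogeneous[OF that(2)] that
    by (intro nondegenerate) (simp add: bilinear_map_simps[OF form_ext_bilinear])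
  have second': "?J \<alpha> \<beta> x (?g y) z = 0"
    if "x \<in> t_comp V \<alpha>" "y \<in> t_comp V \<beta>" for x y z \<alpha> \<beta>
  proof -
    obtain p q where "p \<in> t_comp V 0" "q \<in> t_comp V 1" "z = p + q" by (rule T.homogeneous_cases)
    then show ?thesis using second[OF that] by (simp add: add)
  qed
  have third: "?J \<alpha> \<beta> x y (?g z) = 0"
    if "x \<in> t_comp V \<alpha>" "y \<in> t_comp V \<beta>" "z \<in> t_comp V \<zeta>" for x y z \<alpha> \<beta> \<zeta>
    using shift[of x \<alpha> y \<beta> "?g z" \<zeta>] second'[of y \<beta> z \<zeta>] homogeneous[OF that(3)] that
    by (intro nondegenerate) (simp add: bilinear_map_simps[OF form_ext_bilinear])
  have "?J \<alpha> \<beta> x y z = ?J \<alpha> \<beta> (?e x) y z"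
    using add(1)[of \<alpha> \<beta> "?g x" "?e x" y z] first[OF assms] split[of x] by simp
  also have "\<dots> = ?J \<alpha> \<beta> (?e x) (?e y) z"
    using add(2)[of \<alpha> \<beta> "?e x" "?g y" "?e y" z] second[of "?e x" \<alpha> y \<beta> z \<zeta>]
      homogeneous assms split[of y] by simp
  also have "\<dots> = ?J \<alpha> \<beta> (?e x) (?e y) (?e z)"
    using add(3)[of \<alpha> \<beta> "?e x" "?e y" "?g z" "?e z"] third[of "?e x" \<alpha> "?e y" \<beta> z \<zeta>]
      homogeneous assms split[of z] by simp
  \<comment> \<open>What is left are multiples of \<open>e\<^sub>0\<close> and \<open>e\<^sub>1\<close>; here \<open>B x0 x1 = 0\<close> enters.\<close>
  also have "\<dots> = 0"
    using assms x0 x1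
    by (cases x; cases y; cases z; cases \<alpha>; cases \<beta>)
      (auto simp: T.jacobiator_def parity_linear parity_minus parity_homogeneous br_simps B_simps D_linear s_simps
        B_odd_simps B_x0_x1 B_commute[of x1 x0] D'_x0 D_x0_eq zero_prod_def algebra_simps)
  finally show ?thesis .
qed

lemma lie_superalgebra_t: "lie_superalgebra (t_scale s) (t_comp V) bracket_ext"
proof -
  interpret T: super_vector_space "t_scale s" "t_comp V" by (rule super_vector_space_t)
  have jacobi: "bracket_ext x (bracket_ext y z) =
      bracket_ext (bracket_ext x y) z + t_scale s (ksign (\<alpha> * \<beta>)) (bracket_ext y (bracket_ext x z))"
    if "x \<in> t_comp V \<alpha>" "y \<in> t_comp V \<beta>" "z \<in> t_comp V \<zeta>" for x y z \<alpha> \<beta> \<zeta>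
    using jacobi_ext[OF that] unfolding T.jacobiator_def diff_diff_eq right_minus_eq .
  show ?thesis
    by unfold_locales
      (rule bracket_ext_bilinear bracket_ext_even bracket_ext_skew | rule jacobi, assumption+)+
qed

lemma odd_invariant_scalar_product_t:
  "odd_invariant_scalar_product (t_scale s) (t_comp V) bracket_ext form_ext"
  unfolding odd_invariant_scalar_product_def
  by (intro conjI form_ext_bilinear form_ext_odd form_ext_super invariant_ext form_ext_nondegenerate)

end

section \<open>The theorem\<close>

theorem theorem4p4:
  fixes s :: "'k::{alg_closed_field,field_char_0} \<Rightarrow> 'v::ab_group_add \<Rightarrow> 'v"
    and V :: "bit \<Rightarrow> 'v set"
    and br :: "'v \<Rightarrow> 'v \<Rightarrow> 'v"
    and B :: "'v \<Rightarrow> 'v \<Rightarrow> 'k"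
    and D D' :: "'v \<Rightarrow> 'v"
    and x0 x1 :: 'v
    and k :: 'k
  assumes "odd_quadratic_lie_superalgebra s V br B"
    and "superderivation s V br 0 D" and "skew_supersymmetric_for V B 0 D"
    and "superderivation s V br 1 D'" and "skew_supersymmetric_for V B 1 D'"
    and "x0 \<in> V 0" and "x1 \<in> V 1"
    and "D' \<circ> D' = (\<lambda>X. s (1 / 2) (br x0 X))"
    and "D' x0 = 0"
    and "supercommutator s 0 1 D D' = br x1"
    and "D x0 = s 2 (D' x1)"
    and "B x0 x1 = 0"
  shows "(\<exists>!brt. t_bracket s V br B D D' x0 x1 k brt) \<and>
    (\<exists>!\<gamma>. t_form s V B \<gamma>) \<and>
    (\<forall>brt. t_bracket s V br B D D' x0 x1 k brt \<longrightarrow>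
       lie_superalgebra (t_scale s) (t_comp V) brt \<and>
       (\<forall>\<gamma>. t_form s V B \<gamma> \<longrightarrow> odd_invariant_scalar_product (t_scale s) (t_comp V) brt \<gamma>))"
proof -
  interpret odd_quadratic_lie_superalgebra s V br B by fact
  interpret odd_double_extension s V br B D D' x0 x1 k
    by unfold_locales (fact assms)+
  show ?thesis
    using t_bracket_bracket_ext t_bracket_unique t_form_form_ext t_form_unique
      lie_superalgebra_t odd_invariant_scalar_product_t by metis
qed

end
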